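(* Let $k,w,s,n\in\mathbb Z_{>0}$ and $g\in\{0,1,\ldots,s\}$. Suppose that $n\ge\ell\bigl(\delta_{k,g}^{(w,s)}\bigr)$. Then \[ \frac{P_{\delta_{k,g}^{(w,s)}}(\mathbf t_n;0,t)} {P_{\delta_k^{(w,s)}}(\mathbf t_n;0,t)} =t^{\frac{wkg(g-1)}{2}+\frac{wgs\,k(k-1)}{2}} \begin{bmatrix}n-s(k-1)\\ g\end{bmatrix}_t. \] Equivalently, \[ t^{-\frac{wkg(g-1)}{2}-\frac{wgs\,k(k-1)}{2}} \frac{P_{\delta_{k,g}^{(w,s)}}(\mathbf t_n;0,t)} {P_{\delta_k^{(w,s)}}(\mathbf t_n;0,t)} = \sum_{\nu\subseteq((n-s(k-1)-g)^g)}t^{\lvert\nu\rvert}, \] where the sum is over partitions $\nu$.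
   Context: Partitions are weakly decreasing sequences of nonnegative integers with finitely many nonzero parts; $\ell(\lambda)$ is the number of nonzero parts, $|\lambda|$ the sum of the parts, and $\nu\subseteq\lambda$ means $\nu_i\le\lambda_i$ for all $i$. Exponents on parts denote multiplicities; a part with multiplicity $0$ is omitted. $(m^n)$ is the rectangular partition with $n$ parts equal to $m$; a rectangle of width or height zero is the empty partition. Generalized staircase partitions: for $w,s\in\mathbb Z_{>0}$, $\delta_1^{(w,s)}=\varnothing$ and, for $k\ge2$, $\delta_k^{(w,s)}=\bigl((w(k-1))^s,(w(k-2))^s,\ldots,w^s\bigr)$. Intermediate ones: for $0\le g\le s$, $\delta_{1,g}^{(w,s)}=(w^g)$ (with $\delta_{1,0}^{(w,s)}=\varnothing$) and, for $k\ge2$, $\delta_{k,g}^{(w,s)}=\bigl((wk)^g,(w(k-1))^s,(w(k-2))^s,\ldots,w^s\bigr)$. One has $\ell(\delta_{k,g}^{(w,s)})=s(k-1)+g$. $P_\lambda(x_1,\ldots,x_n;q,t)$ is the monic Macdonald symmetric polynomial (Macdonald's $P$-normalization), and $P_\lambda(x_1,\ldots,x_n;0,t)$ is its specialization at $q=0$, i.e. the monic Hall--Littlewood polynomial $P_\lambda$; $P_\varnothing=1$. $t$ is an indeterminate and $\mathbf t_n=(1,t,\ldots,t^{n-1})$. With $(a;y)_r=\prod_{i=0}^{r-1}(1-ay^i)$, the Gaussian polynomial for integers $a\ge b\ge0$ is $\begin{bmatrix}a\\ b\end{bmatrix}_t=\frac{(t;t)_a}{(t;t)_b(t;t)_{a-b}}$.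 *)

theory Defs
  imports
    "HOL-Library.Poly_Mapping"
    "HOL-Combinatorics.Permutations"
    "HOL-Computational_Algebra.Polynomial"
    "HOL-Computational_Algebra.Fraction_Field"
begin

(* Sequences are indexed from 0: "lam i" is the (i+1)-st part. *)

definition is_partition :: "(nat \<Rightarrow> nat) \<Rightarrow> bool" where
  "is_partition lam \<longleftrightarrow> antimono lam \<and> finite {i. lam i \<noteq> 0}"

definition plength :: "(nat \<Rightarrow> nat) \<Rightarrow> nat" where
  "plength lam = card {i. lam i \<noteq> 0}"

definition psize :: "(nat \<Rightarrow> nat) \<Rightarrow> nat" where
  "psize lam = (\<Sum>i | lam i \<noteq> 0. lam i)"

definition contained :: "(nat \<Rightarrow> nat) \<Rightarrow> (nat \<Rightarrow> nat) \<Rightarrow> bool" where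
  "contained nu lam \<longleftrightarrow> (\<forall>i. nu i \<le> lam i)"

definition parts_of :: "nat list \<Rightarrow> nat \<Rightarrow> nat" where
  "parts_of xs i = (if i < length xs then xs ! i else 0)"

definition rect :: "nat \<Rightarrow> nat \<Rightarrow> (nat \<Rightarrow> nat)" where
  "rect m n = parts_of (replicate n m)"

definition stair_list :: "nat \<Rightarrow> nat \<Rightarrow> nat \<Rightarrow> nat list" where
  "stair_list w s k = concat (map (\<lambda>j. replicate s (w * j)) (rev [1..<k]))"

definition stair :: "nat \<Rightarrow> nat \<Rightarrow> nat \<Rightarrow> (nat \<Rightarrow> nat)" where
  "stair w s k = parts_of (stair_list w s k)"

definition stair_mid :: "nat \<Rightarrow> nat \<Rightarrow> nat \<Rightarrow> nat \<Rightarrow> (nat \<Rightarrow> nat)" where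
  "stair_mid w s k g = parts_of (replicate g (w * k) @ stair_list w s k)"

(* Polynomials over 'a in the variables x_0, x_1, x_2, ...: finitely supported
   maps from exponent vectors to coefficients. *)
type_synonym 'a mpol = "(nat \<Rightarrow>\<^sub>0 nat) \<Rightarrow>\<^sub>0 'a"

definition mvar :: "nat \<Rightarrow> 'a::comm_ring_1 mpol" where
  "mvar i = Poly_Mapping.single (Poly_Mapping.single i 1) 1"

definition mconst :: "'a::comm_ring_1 \<Rightarrow> 'a mpol" where
  "mconst c = Poly_Mapping.single 0 c"

definition meval :: "(nat \<Rightarrow> 'a) \<Rightarrow> 'a mpol \<Rightarrow> 'a::comm_ring_1" where
  "meval x p = (\<Sum>m\<in>Poly_Mapping.keys p.
     Poly_Mapping.lookup p m * (\<Prod>i\<in>Poly_Mapping.keys m. x i ^ Poly_Mapping.lookup m i))"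

definition rvar :: "nat \<Rightarrow> 'a::field mpol fract" where
  "rvar i = Fract (mvar i) 1"

definition rconst :: "'a \<Rightarrow> 'a::field mpol fract" where
  "rconst c = Fract (mconst c) 1"

definition v_num :: "'a::field \<Rightarrow> nat \<Rightarrow> 'a" where
  "v_num t m = (\<Prod>i = 1..m. (1 - t ^ i) / (1 - t))"

(* Product over all multiplicities in (lam 0, ..., lam (n-1)), including the
   multiplicity of the part 0; this makes the polynomial below monic. *)
definition v_part :: "'a::field \<Rightarrow> nat \<Rightarrow> (nat \<Rightarrow> nat) \<Rightarrow> 'a" where
  "v_part t n lam = (\<Prod>j\<in>lam ` {..<n}. v_num t (card {i. i < n \<and> lam i = j}))"

(* Macdonald, Symmetric Functions and Hall Polynomials, III.(2.1)-(2.2):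
     P_lam(x_1,...,x_n;t) = 1/v_lam(t) * sum over sigma in S_n of
       sigma (x_1^lam_1 ... x_n^lam_n * prod_{i<j} (x_i - t x_j) / (x_i - x_j)),
   first as an element of the field of rational functions in the x_i. *)
definition hall_littlewood_rat ::
    "'a::field \<Rightarrow> nat \<Rightarrow> (nat \<Rightarrow> nat) \<Rightarrow> 'a mpol fract" where
  "hall_littlewood_rat t n lam = rconst (1 / v_part t n lam) *
     (\<Sum>\<sigma> | \<sigma> permutes {..<n}.
        (\<Prod>i<n. rvar (\<sigma> i) ^ lam i) *
        (\<Prod>j<n. \<Prod>i<j. (rvar (\<sigma> i) - rconst t * rvar (\<sigma> j)) /
                          (rvar (\<sigma> i) - rvar (\<sigma> j))))"

(* The rational function above is a polynomial. The definition is meant for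
   partitions lam of length at most n. *)
definition hall_littlewood ::
    "'a::field \<Rightarrow> nat \<Rightarrow> (nat \<Rightarrow> nat) \<Rightarrow> 'a mpol" where
  "hall_littlewood t n lam = (THE p. Fract p 1 = hall_littlewood_rat t n lam)"

definition qpoch :: "'a::field \<Rightarrow> 'a \<Rightarrow> nat \<Rightarrow> 'a" where
  "qpoch a y r = (\<Prod>i<r. 1 - a * y ^ i)"

definition gaussian :: "'a::field \<Rightarrow> nat \<Rightarrow> nat \<Rightarrow> 'a" where
  "gaussian t a b = qpoch t t a / (qpoch t t b * qpoch t t (a - b))"

(* The indeterminate t, as an element of the field of rational functions Q(t). *)
definition tvar :: "rat poly fract" where
  "tvar = Fract [:0, 1:] 1"

(* P_lam(1, t, ..., t^(n-1); 0, t): the value of the variable x_i is t^i. *)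
definition HL_spec :: "nat \<Rightarrow> (nat \<Rightarrow> nat) \<Rightarrow> rat poly fract" where
  "HL_spec n lam = meval (\<lambda>i. tvar ^ i) (hall_littlewood tvar n lam)"

end

theory Submission
  imports Defs
begin

text \<open>
  Everything follows from the closed form of the principal specialization,
  \[ P_\lambda(1,t,\ldots,t^{n-1};t) = t^{\sum_i (i-1)\lambda_i}\, v_n(t) / v_\lambda(t), \]
  in which $v_\lambda$ is the product of the $v_{m_j}$ over the multiplicities $m_j$ of the parts
  of $\lambda$, zero included, and $v_m = \prod_{i=1}^m (1 - t^i)/(1 - t)$. In the alternating sum that defines $P_\lambda$, the summand of a
  permutation $\sigma$ contains the factors $x_{\sigma(i)} - t x_{\sigma(j)}$ with $i < j$. At
  $x_i = t^i$ (indices from $0$) such a factor vanishes when $\sigma(i) = \sigma(j) + 1$, and only the identity has no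
  such pair. One summand is left, and its product over pairs telescopes to $v_n(t)$
  (\<open>hl_num_principal\<close>, \<open>principal_specialization\<close>).

  To evaluate at all, $P_\lambda$ must be known to be a polynomial and not just a rational
  function. Over the common denominator, the Vandermonde product, its numerator is an
  antisymmetrization, so it is killed by each substitution $x_c := x_d$ and is therefore divisible
  by $x_c - x_d$. Polynomials over a field form a domain, and $x_c := x_d$ does not kill any of the
  other factors, so these linear factors can be split off one after another
  (\<open>prod_diff_dvd\<close>). Evaluation then commutes with clearing the denominator
  (\<open>meval_hall_littlewood\<close>).

  Passing from $\delta_k$ to $\delta_{k,g}$ puts $g$ new parts $wk$ in front. The multiplicity
  $N = n - s(k-1)$ of the part $0$ splits into $g$ and $N - g$, so the quotient of the $v_\lambda$
  turns into $v_N / (v_g v_{N-g})$, the Gaussian polynomial. The exponent of $t$ changes by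
  $wk\binom g2$ for the new parts and by $g$ times the size of $\delta_k$ for the shift of
  the old ones (\<open>specialization_ratio\<close>). The sum over partitions in a box satisfies the
  same Pascal recurrence as the Gaussian polynomial (\<open>box_split\<close>, \<open>gaussian_pascal\<close>).
\<close>

section \<open>Evaluation of multivariate polynomials\<close>

text \<open>
  The numerator of the Hall--Littlewood polynomial is transported along three maps: the embedding of
  polynomials into rational functions, evaluation at a point, and substitution of one variable for
  another. What transports it is only that these maps respect the ring operations.
\<close>

locale ring_morphism =
  fixes h :: "'a::comm_ring_1 \<Rightarrow> 'b::comm_ring_1"
  assumes one: "h 1 = 1"
    and add: "h (a + b) = h a + h b"
    and mult: "h (a * b) = h a * h b"
begin

lemma zero: "h 0 = 0"
  using add[of 0 0] by simp

lemma uminus: "h (- a) = - h a"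
  using add[of a "- a"] by (simp add: zero minus_unique)

lemma diff: "h (a - b) = h a - h b"
  using add[of a "- b"] by (simp add: uminus)

lemma sum: "h (\<Sum>i\<in>A. f i) = (\<Sum>i\<in>A. h (f i))"
  by (induction A rule: infinite_finite_induct) (simp_all add: zero add)

lemma prod: "h (\<Prod>i\<in>A. f i) = (\<Prod>i\<in>A. h (f i))"
  by (induction A rule: infinite_finite_induct) (simp_all add: one mult)

lemma power: "h (a ^ k) = h a ^ k"
  by (induction k) (simp_all add: one mult)

end

definition monom_val :: "(nat \<Rightarrow> 'b::comm_ring_1) \<Rightarrow> (nat \<Rightarrow>\<^sub>0 nat) \<Rightarrow> 'b" where
  "monom_val x m = (\<Prod>i\<in>Poly_Mapping.keys m. x i ^ Poly_Mapping.lookup m i)"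

lemma monom_val_superset:
  assumes "finite A" "Poly_Mapping.keys m \<subseteq> A"
  shows "monom_val x m = (\<Prod>i\<in>A. x i ^ Poly_Mapping.lookup m i)"
  unfolding monom_val_def using assms
  by (intro prod.mono_neutral_left) (auto simp: in_keys_iff)

lemma monom_val_zero: "monom_val x 0 = 1"
  by (simp add: monom_val_def)

lemma monom_val_add: "monom_val x (m + m') = monom_val x m * monom_val x m'"
proof -
  let ?A = "Poly_Mapping.keys m \<union> Poly_Mapping.keys m'"
  have "monom_val x (m + m') = (\<Prod>i\<in>?A. x i ^ Poly_Mapping.lookup (m + m') i)"
    by (intro monom_val_superset keys_add) simp
  also have "\<dots> = (\<Prod>i\<in>?A. x i ^ Poly_Mapping.lookup m i) * (\<Prod>i\<in>?A. x i ^ Poly_Mapping.lookup m' i)"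
    by (simp add: lookup_add power_add prod.distrib)
  also have "\<dots> = monom_val x m * monom_val x m'"
    by (simp add: monom_val_superset[of ?A])
  finally show ?thesis .
qed

lemma monom_val_single: "monom_val x (Poly_Mapping.single i k) = x i ^ k"
  by (simp add: monom_val_def)

lemma mpol_as_sum:
  fixes p :: "'a::comm_ring_1 mpol"
  shows "p = (\<Sum>m\<in>Poly_Mapping.keys p. Poly_Mapping.single m (Poly_Mapping.lookup p m))"
proof (rule poly_mapping_eqI)
  fix k
  show "Poly_Mapping.lookup p k =
    Poly_Mapping.lookup (\<Sum>m\<in>Poly_Mapping.keys p. Poly_Mapping.single m (Poly_Mapping.lookup p m)) k"
    by (auto simp: lookup_sum lookup_single when_def in_keys_iff)
qed

text \<open>
  Evaluation with an arbitrary morphism \<open>h\<close> on the coefficients: the identity gives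
  \<open>meval\<close>, while \<open>mconst\<close> gives substitution of polynomials for the variables.
\<close>

definition mpeval :: "('a::comm_ring_1 \<Rightarrow> 'b::comm_ring_1) \<Rightarrow> (nat \<Rightarrow> 'b) \<Rightarrow> 'a mpol \<Rightarrow> 'b" where
  "mpeval h x p = (\<Sum>m\<in>Poly_Mapping.keys p. h (Poly_Mapping.lookup p m) * monom_val x m)"

lemma meval_conv_mpeval: "meval x = mpeval (\<lambda>c. c) x"
  by (simp add: fun_eq_iff meval_def mpeval_def monom_val_def)

context ring_morphism
begin

lemma mpeval_superset:
  assumes "finite A" "Poly_Mapping.keys p \<subseteq> A"
  shows "mpeval h x p = (\<Sum>m\<in>A. h (Poly_Mapping.lookup p m) * monom_val x m)"
  unfolding mpeval_def using assms
  by (intro sum.mono_neutral_left) (auto simp: in_keys_iff zero)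

lemma mpeval_single: "mpeval h x (Poly_Mapping.single m c) = h c * monom_val x m"
  by (simp add: mpeval_def zero)

lemma mpeval_mconst: "mpeval h x (mconst c) = h c"
  by (simp add: mconst_def mpeval_single monom_val_zero)

lemma mpeval_mvar: "mpeval h x (mvar i) = x i"
  by (simp add: mvar_def mpeval_single monom_val_single one)

lemma mpeval_add: "mpeval h x (p + q) = mpeval h x p + mpeval h x q"
proof -
  let ?A = "Poly_Mapping.keys p \<union> Poly_Mapping.keys q"
  have "mpeval h x (p + q) = (\<Sum>m\<in>?A. h (Poly_Mapping.lookup (p + q) m) * monom_val x m)"
    by (intro mpeval_superset keys_add) simp
  also have "\<dots> = (\<Sum>m\<in>?A. h (Poly_Mapping.lookup p m) * monom_val x m)
                  + (\<Sum>m\<in>?A. h (Poly_Mapping.lookup q m) * monom_val x m)"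
    by (simp add: lookup_add add distrib_right sum.distrib)
  also have "\<dots> = mpeval h x p + mpeval h x q"
    by (simp add: mpeval_superset[of ?A])
  finally show ?thesis .
qed

lemma mpeval_sum: "mpeval h x (\<Sum>i\<in>I. f i) = (\<Sum>i\<in>I. mpeval h x (f i))"
  by (induction I rule: infinite_finite_induct) (simp_all add: mpeval_add, simp_all add: mpeval_def)

lemma mpeval_mult: "mpeval h x (p * q) = mpeval h x p * mpeval h x q"
proof -
  let ?s = "\<lambda>p m. Poly_Mapping.single m (Poly_Mapping.lookup p m)"
  let ?K = "Poly_Mapping.keys"
  have "mpeval h x (p * q) = mpeval h x ((\<Sum>m\<in>?K p. ?s p m) * (\<Sum>m\<in>?K q. ?s q m))"
    by (simp flip: mpol_as_sum)
  also have "\<dots> = (\<Sum>m\<in>?K p. \<Sum>m'\<in>?K q. mpeval h x (?s p m * ?s q m'))"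
    by (simp only: sum_product mpeval_sum)
  also have "\<dots> = (\<Sum>m\<in>?K p. \<Sum>m'\<in>?K q. (h (Poly_Mapping.lookup p m) * monom_val x m)
                     * (h (Poly_Mapping.lookup q m') * monom_val x m'))"
    by (simp add: mult_single mpeval_single mult monom_val_add algebra_simps)
  also have "\<dots> = mpeval h x p * mpeval h x q"
    by (simp add: mpeval_def sum_product)
  finally show ?thesis .
qed

lemma ring_morphism_mpeval: "ring_morphism (mpeval h x)"
  by unfold_locales
    (simp_all add: mpeval_add mpeval_mult one mpeval_mconst[of x 1, unfolded mconst_def, simplified])

end

lemma ring_morphism_mconst: "ring_morphism (mconst :: 'a::comm_ring_1 \<Rightarrow> _)"
  by unfold_locales (simp_all add: mconst_def single_add mult_single)

lemma ring_morphism_meval: "ring_morphism (meval x)"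
proof -
  interpret ring_morphism "\<lambda>c::'a. c" by unfold_locales simp_all
  show ?thesis unfolding meval_conv_mpeval by (rule ring_morphism_mpeval)
qed

lemma meval_mvar: "meval x (mvar i) = x i"
proof -
  interpret ring_morphism "\<lambda>c::'a. c" by unfold_locales simp_all
  show ?thesis unfolding meval_conv_mpeval by (rule mpeval_mvar)
qed

lemma meval_mconst: "meval x (mconst c) = c"
proof -
  interpret ring_morphism "\<lambda>c::'a. c" by unfold_locales simp_all
  show ?thesis unfolding meval_conv_mpeval by (rule mpeval_mconst)
qed

lemma ring_morphism_Fract: "ring_morphism (\<lambda>p::'a::idom. Fract p 1)"
  by unfold_locales (simp_all add: One_fract_def)

lemma Fract_1_eq_iff: "Fract a 1 = Fract b 1 \<longleftrightarrow> a = (b::'a::idom)"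
  by (simp add: eq_fract)

lemma monom_val_mvar: "mconst c * monom_val mvar m = Poly_Mapping.single m (c::'a::comm_ring_1)"
proof -
  have sgl: "mvar i ^ k = Poly_Mapping.single (Poly_Mapping.single i k) (1::'a)" for i k
    by (induction k) (simp_all add: mvar_def mult_single flip: single_add single_one)
  have prod_sgl: "(\<Prod>i\<in>I. Poly_Mapping.single (f i) (1::'a)) = Poly_Mapping.single (\<Sum>i\<in>I. f i) 1"
    for I :: "nat set" and f :: "nat \<Rightarrow> (nat \<Rightarrow>\<^sub>0 nat)"
    by (induction I rule: infinite_finite_induct) (simp_all add: mult_single)
  have "(\<Sum>i\<in>Poly_Mapping.keys m. Poly_Mapping.single i (Poly_Mapping.lookup m i)) = m"
    by (rule poly_mapping_eqI) (auto simp: lookup_sum lookup_single when_def in_keys_iff)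
  then show ?thesis
    by (simp add: monom_val_def sgl prod_sgl mconst_def mult_single)
qed

section \<open>Divisibility by differences of variables\<close>

definition subst_var :: "nat \<Rightarrow> nat \<Rightarrow> 'a::comm_ring_1 mpol \<Rightarrow> 'a mpol" where
  "subst_var c d = mpeval mconst (mvar \<circ> id(c := d))"

lemma ring_morphism_subst_var: "ring_morphism (subst_var c d)"
  unfolding subst_var_def by (rule ring_morphism.ring_morphism_mpeval[OF ring_morphism_mconst])

lemma dvd_diff_power: "D dvd a - b \<Longrightarrow> D dvd a ^ k - (b::'a::comm_ring_1) ^ k"
proof (induction k)
  case (Suc k)
  have "a ^ Suc k - b ^ Suc k = a * (a ^ k - b ^ k) + (a - b) * b ^ k"
    by (simp add: algebra_simps)
  with Suc show ?case by (metis dvd_add dvd_mult dvd_mult2)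
qed simp

lemma dvd_diff_prod:
  assumes "\<And>i. i \<in> I \<Longrightarrow> D dvd f i - g i"
  shows "D dvd (\<Prod>i\<in>I. f i) - (\<Prod>i\<in>I. (g i :: 'a::comm_ring_1))"
  using assms
proof (induction I rule: infinite_finite_induct)
  case (insert i I)
  have "(\<Prod>i\<in>insert i I. f i) - (\<Prod>i\<in>insert i I. g i)
      = f i * (prod f I - prod g I) + (f i - g i) * prod g I"
    using insert by (simp add: algebra_simps)
  with insert show ?case by (metis dvd_add dvd_mult dvd_mult2 insertCI)
qed simp_all

text \<open>
  Modulo $x_c - x_d$ the variables $x_c$ and $x_d$ agree, hence so do a polynomial and its image
  under $x_c := x_d$. This is how vanishing under the substitution turns into divisibility.
\<close>

lemma dvd_diff_subst_var: "mvar c - mvar d dvd p - subst_var c d (p :: 'a::comm_ring_1 mpol)"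
proof -
  let ?D = "mvar c - mvar d :: 'a mpol"
  let ?y = "mvar \<circ> id(c := d) :: nat \<Rightarrow> 'a mpol"
  have eq: "p - subst_var c d p =
     (\<Sum>m\<in>Poly_Mapping.keys p. mconst (Poly_Mapping.lookup p m) * (monom_val mvar m - monom_val ?y m))"
    by (subst mpol_as_sum)
      (simp add: subst_var_def mpeval_def monom_val_mvar sum_subtractf right_diff_distrib)
  have "?D dvd monom_val mvar m - monom_val ?y m" for m
    unfolding monom_val_def by (intro dvd_diff_prod dvd_diff_power) simp
  then show ?thesis
    unfolding eq by (intro dvd_sum dvd_mult)
qed

lemma mvar_inj: "mvar i = (mvar j :: 'a::comm_ring_1 mpol) \<Longrightarrow> i = j"
proof -
  assume "mvar i = (mvar j :: 'a mpol)"
  then have "Poly_Mapping.lookup (mvar i :: 'a mpol) (Poly_Mapping.single i 1)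
    = Poly_Mapping.lookup (mvar j :: 'a mpol) (Poly_Mapping.single i 1)" by simp
  then have "Poly_Mapping.single j (1::nat) = Poly_Mapping.single i 1"
    by (auto simp: mvar_def lookup_single when_def split: if_splits)
  then show "i = j"
    by (metis lookup_single_eq lookup_single_not_eq one_neq_zero)
qed

text \<open>
  If $F = \prod_A (x_a - x_b) \cdot G$ and $x_c := x_d$ kills $F$, it kills $G$, because it maps
  none of the factors in $A$ to zero. So $x_c - x_d$ divides $G$, and one more factor splits off.
  The ordering $c < d$ of the pairs keeps $(d,c)$, whose factor the substitution does
  kill, out of $A$.
\<close>

lemma prod_diff_dvd:
  fixes F :: "'a::idom mpol"
  assumes "finite A" "A \<subseteq> {(c, d). c < d}"
    and "\<And>c d. (c, d) \<in> A \<Longrightarrow> subst_var c d F = 0"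
  shows "(\<Prod>(c, d)\<in>A. mvar c - mvar d) dvd F"
  using assms
proof (induction A rule: finite_induct)
  case (insert e A)
  obtain c d where e: "e = (c, d)" by (cases e)
  with insert have cd: "c < d" by auto
  interpret s: ring_morphism "subst_var c d" by (rule ring_morphism_subst_var)
  let ?P = "\<Prod>(a, b)\<in>A. mvar a - mvar b :: 'a mpol"
  obtain G where G: "F = ?P * G"
    using insert by (auto elim!: dvdE)
  have "subst_var c d F = 0" using insert e by auto
  then have "subst_var c d ?P * subst_var c d G = 0"
    by (simp add: G s.mult)
  moreover have "subst_var c d ?P \<noteq> 0"
  proof -
    have "subst_var c d (mvar a - mvar b) \<noteq> (0 :: 'a mpol)" if "(a, b) \<in> A" for a b
    proof
      assume "subst_var c d (mvar a - mvar b) = (0 :: 'a mpol)"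
      then have "mvar ((id(c := d)) a) = (mvar ((id(c := d)) b) :: 'a mpol)"
        unfolding s.diff
        by (simp add: subst_var_def ring_morphism.mpeval_mvar[OF ring_morphism_mconst] del: fun_upd_apply)
      then have "(id(c := d)) a = (id(c := d)) b" by (rule mvar_inj)
      moreover have "a < b" "(a, b) \<noteq> (c, d)" using that insert e by auto
      ultimately show False using cd by (auto split: if_splits)
    qed
    then show ?thesis
      using insert(1) by (auto simp: s.prod split_def)
  qed
  ultimately have "subst_var c d G = 0" by simp
  with dvd_diff_subst_var[of c d G] have "mvar c - mvar d dvd G" by simp
  then show ?case
    using insert(1,2) unfolding G by (simp add: e mult.commute[of "mvar c - mvar d"] mult_dvd_mono)
qed simp

section \<open>The Vandermonde product under permutations\<close>

definition vandermonde :: "nat \<Rightarrow> (nat \<Rightarrow> 'a::comm_ring_1) \<Rightarrow> 'a" where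
  "vandermonde n y = (\<Prod>j<n. \<Prod>i<j. y i - y j)"

lemma prod_triangle:
  fixes f :: "nat \<Rightarrow> nat \<Rightarrow> 'a::comm_monoid_mult"
  shows "(\<Prod>j<n. \<Prod>i<j. f i j) = (\<Prod>(i, j)\<in>{(i, j). i < j \<and> j < n}. f i j)"
proof -
  have "(\<Prod>j<n. \<Prod>i<j. f i j) = (\<Prod>(j, i)\<in>Sigma {..<n} (\<lambda>j. {..<j}). f i j)"
    by (subst prod.Sigma) auto
  also have "\<dots> = (\<Prod>(i, j)\<in>{(i, j). i < j \<and> j < n}. f i j)"
    by (rule prod.reindex_bij_witness[where i = prod.swap and j = prod.swap]) auto
  finally show ?thesis .
qed

lemma finite_triangle: "finite {(i, j). i < j \<and> j < (n::nat)}"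
  by (rule finite_subset[of _ "{..<n} \<times> {..<n}"]) auto

text \<open>
  Applying the transposition to a pair $i < j$ gives another pair up to order, and this is a
  bijection on pairs; each inverted pair contributes a sign. The inverted pairs are $(a,b)$ and, for
  each $c$ strictly between, both $(a,c)$ and $(c,b)$, so their number is odd.
\<close>

lemma vandermonde_transpose:
  assumes "a < b" "b < n"
  shows "vandermonde n (y \<circ> Transposition.transpose a b) = - vandermonde n y"
proof -
  let ?t = "Transposition.transpose a b"
  let ?P = "{(i, j). i < j \<and> j < n}"
  let ?I = "{p \<in> ?P. ?t (snd p) < ?t (fst p)}"
  let ?s = "\<lambda>p. if p \<in> ?I then - 1 else 1 :: 'a"
  define \<phi> where "\<phi> = (\<lambda>(i, j). (min (?t i) (?t j), max (?t i) (?t j)))"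
  have t_less: "?t i < n" if "i < n" for i
    using that assms by (auto simp: Transposition.transpose_def)
  have t_neq: "?t i \<noteq> ?t j" if "i \<noteq> j" for i j
    using that by (metis transpose_involutory)
  have \<phi>\<phi>: "\<phi> (\<phi> p) = p" if "p \<in> ?P" for p
    using that by (cases p) (auto simp: \<phi>_def min_def max_def)
  have \<phi>P: "\<phi> p \<in> ?P" if "p \<in> ?P" for p
    using that t_less t_neq[of "fst p" "snd p"] by (auto simp: \<phi>_def min_def max_def)
  have I: "?I = insert (a, b) ((\<lambda>c. (a, c)) ` {a<..<b} \<union> (\<lambda>c. (c, b)) ` {a<..<b})"
    using assms by (auto simp: Transposition.transpose_def image_iff split: if_splits)
  have "card ((\<lambda>c. (a, c)) ` {a<..<b} \<union> (\<lambda>c. (c, b)) ` {a<..<b}) = 2 * card {a<..<b}"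
    by (subst card_Un_disjoint) (auto simp: card_image inj_on_def)
  then have "card ?I = Suc (2 * card {a<..<b})"
    unfolding I by (subst card.insert) auto
  moreover have "(\<Prod>p\<in>?P. ?s p) = (- 1) ^ card ?I"
  proof -
    have "(\<Prod>p\<in>?P. ?s p) = (\<Prod>p\<in>?I. - 1)"
      by (intro prod.mono_neutral_cong_right finite_triangle) auto
    then show ?thesis by simp
  qed
  ultimately have sgn: "(\<Prod>p\<in>?P. ?s p) = - 1" by simp
  have "vandermonde n (y \<circ> ?t) = (\<Prod>p\<in>?P. y (?t (fst p)) - y (?t (snd p)))"
    by (simp add: vandermonde_def prod_triangle split_def)
  also have "\<dots> = (\<Prod>p\<in>?P. ?s p * (y (fst (\<phi> p)) - y (snd (\<phi> p))))"
    by (rule prod.cong) (auto simp: \<phi>_def)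
  also have "\<dots> = - (\<Prod>p\<in>?P. y (fst (\<phi> p)) - y (snd (\<phi> p)))"
    by (simp add: prod.distrib sgn del: mem_Collect_eq)
  also have "(\<Prod>p\<in>?P. y (fst (\<phi> p)) - y (snd (\<phi> p))) = (\<Prod>p\<in>?P. y (fst p) - y (snd p))"
    by (rule prod.reindex_bij_witness[where i = \<phi> and j = \<phi>]) (simp_all only: \<phi>\<phi> \<phi>P)
  also have "\<dots> = vandermonde n y"
    by (simp add: vandermonde_def prod_triangle split_def)
  finally show ?thesis .
qed

lemma vandermonde_permute:
  assumes "\<sigma> permutes {..<n}"
  shows "vandermonde n (y \<circ> \<sigma>) = of_int (sign \<sigma>) * vandermonde n y"
  using assms finite_lessThan
proof (induction \<sigma> arbitrary: y rule: permutes_induct)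
  case (swap a b p)
  let ?t = "Transposition.transpose a b"
  have "vandermonde n (y \<circ> ?t) = - vandermonde n y"
    using swap(1-3) vandermonde_transpose[of a b n y] vandermonde_transpose[of b a n y]
    by (cases a b rule: linorder_cases) (auto simp: transpose_commute)
  moreover have "sign (?t \<circ> p) = - sign p"
    using swap(3) permutes_imp_permutation[OF finite_lessThan swap(4)]
    by (simp add: sign_compose sign_swap_id permutation_swap_id)
  moreover have "vandermonde n (y \<circ> (?t \<circ> p)) = of_int (sign p) * vandermonde n (y \<circ> ?t)"
    using swap(5)[of "y \<circ> ?t"] by (simp only: o_assoc)
  ultimately show ?case
    by (simp only: of_int_minus mult_minus_left mult_minus_right)
qed simp

section \<open>Hall--Littlewood polynomials are polynomials\<close>

definition antisym_sum :: "nat \<Rightarrow> ((nat \<Rightarrow> 'a) \<Rightarrow> 'a) \<Rightarrow> (nat \<Rightarrow> 'a) \<Rightarrow> 'a::comm_ring_1" where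
  "antisym_sum n G y = (\<Sum>\<sigma> | \<sigma> permutes {..<n}. of_int (sign \<sigma>) * G (y \<circ> \<sigma>))"

text \<open>
  Composition with the transposition of $c$ and $d$ pairs the even permutations with the odd ones
  and does not affect $y$, so the terms cancel in pairs. Pairing them, in place of showing that the
  sum equals its own negative, gives the result in every characteristic.
\<close>

lemma antisym_sum_eq_0:
  assumes "c < d" "d < n" "y c = y d"
  shows "antisym_sum n G y = 0"
proof -
  let ?t = "Transposition.transpose c d"
  let ?S = "{\<sigma>. \<sigma> permutes {..<n}}"
  let ?f = "\<lambda>\<sigma>. of_int (sign \<sigma>) * G (y \<circ> \<sigma>)"
  have t: "?t permutes {..<n}" using assms by (intro permutes_swap_id) auto
  have yt: "y \<circ> ?t = y" using assms by (auto simp: fun_eq_iff Transposition.transpose_def)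
  have sgn: "sign (?t \<circ> \<sigma>) = - sign \<sigma>" if "\<sigma> permutes {..<n}" for \<sigma>
    using assms(1) permutes_imp_permutation[OF finite_lessThan that]
    by (simp add: sign_compose sign_swap_id permutation_swap_id)
  have f: "?f (?t \<circ> \<sigma>) = - ?f \<sigma>" if "\<sigma> permutes {..<n}" for \<sigma>
    using that by (simp add: sgn o_assoc yt)
  have tS: "?t \<circ> \<sigma> permutes {..<n}" if "\<sigma> permutes {..<n}" for \<sigma>
    using that t by (rule permutes_compose)
  have tt: "?t \<circ> (?t \<circ> \<sigma>) = \<sigma>" for \<sigma> :: "nat \<Rightarrow> nat"
    by (simp add: o_assoc)
  have fin: "finite ?S" by (simp add: finite_permutations)
  have "antisym_sum n G y = (\<Sum>\<sigma>\<in>?S. ?f \<sigma>)" by (simp add: antisym_sum_def)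
  also have "\<dots> = (\<Sum>\<sigma>\<in>{\<sigma>\<in>?S. sign \<sigma> = 1}. ?f \<sigma>) + (\<Sum>\<sigma>\<in>{\<sigma>\<in>?S. sign \<sigma> \<noteq> 1}. ?f \<sigma>)"
    by (subst sum.union_disjoint[symmetric]) (use fin in \<open>auto intro: sum.cong\<close>)
  also have "(\<Sum>\<sigma>\<in>{\<sigma>\<in>?S. sign \<sigma> \<noteq> 1}. ?f \<sigma>) = (\<Sum>\<sigma>\<in>{\<sigma>\<in>?S. sign \<sigma> = 1}. - ?f \<sigma>)"
    by (rule sum.reindex_bij_witness[where i = "\<lambda>\<sigma>. ?t \<circ> \<sigma>" and j = "\<lambda>\<sigma>. ?t \<circ> \<sigma>"])
      (use f tS in \<open>auto simp: tt sgn, auto simp: sign_def split: if_splits\<close>)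
  finally show ?thesis by (simp add: sum_negf comp_def)
qed

text \<open>
  The term of the identity permutation in the Hall--Littlewood sum, cleared of its denominator. It
  is stated over any commutative ring since it is needed for polynomials, for rational functions
  and for values.
\<close>

definition hl_summand :: "'a \<Rightarrow> nat \<Rightarrow> (nat \<Rightarrow> nat) \<Rightarrow> (nat \<Rightarrow> 'a::comm_ring_1) \<Rightarrow> 'a" where
  "hl_summand t n lam y = (\<Prod>i<n. y i ^ lam i) * (\<Prod>j<n. \<Prod>i<j. y i - t * y j)"

abbreviation hl_num :: "'a \<Rightarrow> nat \<Rightarrow> (nat \<Rightarrow> nat) \<Rightarrow> (nat \<Rightarrow> 'a::comm_ring_1) \<Rightarrow> 'a" where
  "hl_num t n lam \<equiv> antisym_sum n (hl_summand t n lam)"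

lemma (in ring_morphism) hl_num: "h (hl_num t n lam y) = hl_num (h t) n lam (h \<circ> y)"
proof -
  have of_int: "h (of_int (sign \<sigma>)) = of_int (sign \<sigma>)" for \<sigma> :: "nat \<Rightarrow> nat"
    by (simp add: sign_def one uminus)
  show ?thesis
    by (simp add: antisym_sum_def hl_summand_def sum mult of_int prod power diff)
qed

lemma (in ring_morphism) vandermonde: "h (vandermonde n y) = vandermonde n (h \<circ> y)"
  by (simp add: vandermonde_def prod diff)

lemma vandermonde_dvd_hl_num:
  "vandermonde n mvar dvd hl_num (mconst t) n lam (mvar :: nat \<Rightarrow> 'a::idom mpol)"
proof -
  have "subst_var c d (hl_num (mconst t) n lam mvar) = (0 :: 'a mpol)"
    if "c < d" "d < n" for c d
  proof -
    interpret s: ring_morphism "subst_var c d :: 'a mpol \<Rightarrow> _" by (rule ring_morphism_subst_var)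
    show ?thesis unfolding s.hl_num
      by (rule antisym_sum_eq_0[OF that])
        (use that in \<open>simp add: subst_var_def ring_morphism.mpeval_mvar[OF ring_morphism_mconst]\<close>)
  qed
  then show ?thesis
    unfolding vandermonde_def prod_triangle by (intro prod_diff_dvd finite_triangle) auto
qed

lemma vandermonde_mvar_nz: "vandermonde n (mvar :: nat \<Rightarrow> 'a::idom mpol) \<noteq> 0"
  by (auto simp: vandermonde_def dest: mvar_inj)

text \<open>
  The denominators in the defining sum are permuted Vandermonde products, that is, the Vandermonde
  product up to the sign of the permutation; this sign is what makes the numerator alternating.
\<close>

lemma hall_littlewood_rat_conv_hl_num:
  "hall_littlewood_rat t n lam =
     rconst (1 / v_part t n lam) * (hl_num (rconst t) n lam rvar / vandermonde n rvar)"
proof -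
  have "(\<Prod>i<n. rvar (\<sigma> i) ^ lam i) *
        (\<Prod>j<n. \<Prod>i<j. (rvar (\<sigma> i) - rconst t * rvar (\<sigma> j)) / (rvar (\<sigma> i) - rvar (\<sigma> j)))
      = of_int (sign \<sigma>) * hl_summand (rconst t) n lam (rvar \<circ> \<sigma>) / vandermonde n rvar"
    if "\<sigma> permutes {..<n}" for \<sigma>
  proof -
    have "(\<Prod>j<n. \<Prod>i<j. (rvar (\<sigma> i) - rconst t * rvar (\<sigma> j)) / (rvar (\<sigma> i) - rvar (\<sigma> j)))
       = (\<Prod>j<n. \<Prod>i<j. rvar (\<sigma> i) - rconst t * rvar (\<sigma> j)) / vandermonde n (rvar \<circ> \<sigma>)"
      by (simp add: vandermonde_def prod_dividef)
    moreover have "x / (of_int (sign \<sigma>) * y) = of_int (sign \<sigma>) * x / y" for x y :: "'a mpol fract"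
      by (simp add: sign_def)
    ultimately show ?thesis
      by (simp add: hl_summand_def vandermonde_permute[OF that])
  qed
  then show ?thesis
    by (simp add: hall_littlewood_rat_def antisym_sum_def sum_divide_distrib)
qed

text \<open>
  The quotient of numerator and Vandermonde product witnesses that the defining description of
  the Hall--Littlewood polynomial is satisfied. The equation for \<open>G\<close> is free of denominators,
  so it can be evaluated at any point.
\<close>

lemma hall_littlewood_polynomial:
  obtains G where "vandermonde n mvar * G = hl_num (mconst t) n lam mvar"
    and "hall_littlewood t n lam = mconst (1 / v_part t n lam) * G"
proof -
  obtain G where G: "hl_num (mconst t) n lam mvar = vandermonde n mvar * G"
    using vandermonde_dvd_hl_num unfolding dvd_def by blast
  interpret F: ring_morphism "\<lambda>p::'a mpol. Fract p 1" by (rule ring_morphism_Fract)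
  have mv: "(\<lambda>p::'a mpol. Fract p 1) \<circ> mvar = rvar" by (simp add: fun_eq_iff rvar_def)
  have num: "hl_num (rconst t) n lam rvar = vandermonde n rvar * Fract G 1"
    using arg_cong[OF G, of "\<lambda>p. Fract p 1"]
    unfolding F.mult F.hl_num F.vandermonde mv rconst_def[symmetric] .
  have "vandermonde n (rvar :: nat \<Rightarrow> 'a mpol fract) = Fract (vandermonde n mvar) 1"
    unfolding F.vandermonde mv ..
  then have "vandermonde n (rvar :: nat \<Rightarrow> 'a mpol fract) \<noteq> 0"
    by (simp add: vandermonde_mvar_nz eq_fract Zero_fract_def)
  then have "hall_littlewood_rat t n lam = rconst (1 / v_part t n lam) * Fract G 1"
    by (simp add: hall_littlewood_rat_conv_hl_num num)
  then have "hall_littlewood_rat t n lam = Fract (mconst (1 / v_part t n lam) * G) 1"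
    by (simp add: rconst_def)
  then have "hall_littlewood t n lam = mconst (1 / v_part t n lam) * G"
    unfolding hall_littlewood_def by (intro the_equality) (simp_all add: Fract_1_eq_iff)
  with G show ?thesis by (intro that[of G]) simp_all
qed

lemma meval_hall_littlewood:
  "meval x (hall_littlewood t n lam) * vandermonde n x = hl_num t n lam x / v_part t n lam"
proof -
  obtain G where G: "vandermonde n mvar * G = hl_num (mconst t) n lam mvar"
    "hall_littlewood t n lam = mconst (1 / v_part t n lam) * G"
    by (rule hall_littlewood_polynomial)
  interpret e: ring_morphism "meval x" by (rule ring_morphism_meval)
  have xv: "meval x \<circ> mvar = x" by (simp add: fun_eq_iff meval_mvar)
  have "vandermonde n x * meval x G = hl_num t n lam x"
    using arg_cong[OF G(1), of "meval x"] by (simp add: e.mult e.hl_num e.vandermonde xv meval_mconst)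
  then show ?thesis
    by (simp add: G(2) e.mult meval_mconst mult.commute)
qed

section \<open>The principal specialization\<close>

text \<open>
  The condition says that in the sequence $\sigma(0), \ldots, \sigma(n-1)$ no value $v + 1$ stands
  to the left of $v$. Hence the position of $v$ increases with $v$, which only the identity allows.
\<close>

lemma permutes_no_descent_imp_id:
  assumes "\<sigma> permutes {..<n}"
    and "\<And>i j. i < j \<Longrightarrow> j < n \<Longrightarrow> \<sigma> i \<noteq> Suc (\<sigma> j)"
  shows "\<sigma> = id"
proof -
  let ?p = "inv \<sigma>"
  have p: "?p permutes {..<n}" using assms(1) by (rule permutes_inv)
  have lt: "?p v < n" if "v < n" for v using permutes_in_image[OF p, of v] that by simp
  have sp: "\<sigma> (?p v) = v" for v using assms(1) by (rule permutes_inverses)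
  have step: "?p v < ?p (Suc v)" if "Suc v < n" for v
  proof (rule ccontr)
    assume "\<not> ?p v < ?p (Suc v)"
    moreover have "?p v \<noteq> ?p (Suc v)" by (metis sp n_not_Suc_n)
    ultimately have "?p (Suc v) < ?p v" by simp
    from assms(2)[OF this] lt[of v] that show False by (simp add: sp)
  qed
  have "v \<le> ?p v" if "v < n" for v
    using that
  proof (induction v)
    case (Suc v)
    with step[of v] show ?case by simp
  qed simp
  then have "?p = id" using permutes_natset_ge[OF p] by simp
  then show ?thesis by (metis assms(1) inv_id permutes_inv_inv)
qed

lemma hl_num_principal:
  "hl_num t n lam (\<lambda>i. t ^ i) = hl_summand t n lam (\<lambda>i. t ^ i)"
proof -
  have "hl_summand t n lam ((\<lambda>i. t ^ i) \<circ> \<sigma>) = 0" if \<sigma>: "\<sigma> permutes {..<n}" "\<sigma> \<noteq> id" for \<sigma>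
  proof -
    obtain i j where ij: "i < j" "j < n" "\<sigma> i = Suc (\<sigma> j)"
      using permutes_no_descent_imp_id \<sigma> by blast
    then have "(\<Prod>i<j. t ^ \<sigma> i - t * t ^ \<sigma> j) = 0"
      by (intro prod_zero) (auto intro!: bexI[of _ i])
    with ij have "(\<Prod>j<n. \<Prod>i<j. t ^ \<sigma> i - t * t ^ \<sigma> j) = 0"
      by (intro prod_zero) (auto intro!: bexI[of _ j])
    then show ?thesis by (simp add: hl_summand_def)
  qed
  then have "hl_num t n lam (\<lambda>i. t ^ i)
    = (\<Sum>\<sigma>\<in>{id}. of_int (sign \<sigma>) * hl_summand t n lam ((\<lambda>i. t ^ i) \<circ> \<sigma>))"
    unfolding antisym_sum_def
    by (intro sum.mono_neutral_right) (auto simp: finite_permutations permutes_id)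
  then show ?thesis by simp
qed

text \<open>
  Up to powers of $t$, the left product runs over $1 - t^m$ for $2 \le m \le j + 1$ and the right
  one over $1 - t^m$ for $1 \le m \le j$; the outer factors restore the ends. Stated without
  division, it holds in any commutative ring.
\<close>

lemma prod_t_shift:
  fixes t :: "'a::comm_ring_1"
  shows "(\<Prod>i<j. t ^ i - t * t ^ j) * (1 - t) = (1 - t ^ Suc j) * (\<Prod>i<j. t ^ i - t ^ j)"
proof (induction j)
  case (Suc j)
  have shift: "(\<Prod>i<Suc j. t ^ i - t * c) = (1 - t * c) * (t ^ j * (\<Prod>i<j. t ^ i - c))" for c
  proof -
    have "(\<Prod>i<Suc j. t ^ i - t * c) = (1 - t * c) * (\<Prod>i<j. t * (t ^ i - c))"
      by (simp only: prod.lessThan_Suc_shift) (simp add: right_diff_distrib)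
    then show ?thesis by (simp add: prod.distrib)
  qed
  have "(\<Prod>i<Suc j. t ^ i - t * t ^ Suc j) * (1 - t)
      = (1 - t ^ Suc (Suc j)) * t ^ j * ((\<Prod>i<j. t ^ i - t * t ^ j) * (1 - t))"
    by (simp only: shift) (simp add: algebra_simps)
  also have "\<dots> = (1 - t ^ Suc (Suc j)) * ((1 - t * t ^ j) * (t ^ j * (\<Prod>i<j. t ^ i - t ^ j)))"
    by (simp only: Suc.IH) (simp add: algebra_simps)
  also have "\<dots> = (1 - t ^ Suc (Suc j)) * (\<Prod>i<Suc j. t ^ i - t ^ Suc j)"
    by (simp only: shift[of "t ^ j", symmetric]) simp
  finally show ?case .
qed simp

lemma principal_specialization:
  fixes t :: "'a::field"
  assumes t0: "t \<noteq> 0" and t1: "\<And>i. i > 0 \<Longrightarrow> t ^ i \<noteq> 1"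
  shows "meval (\<lambda>i. t ^ i) (hall_littlewood t n lam)
           = t ^ (\<Sum>i<n. i * lam i) * v_num t n / v_part t n lam"
proof -
  have inj: "t ^ i \<noteq> t ^ j" if "i < j" for i j
  proof
    assume "t ^ i = t ^ j"
    then have "t ^ (j - i) = 1" using that t0 by (simp add: power_diff)
    with t1[of "j - i"] that show False by simp
  qed
  have V: "vandermonde n (\<lambda>i. t ^ i) \<noteq> 0"
    by (auto simp: vandermonde_def dest: inj)
  have "1 - t \<noteq> 0" using t1[of 1] by simp
  then have "(\<Prod>i<j. t ^ i - t * t ^ j) = (1 - t ^ Suc j) / (1 - t) * (\<Prod>i<j. t ^ i - t ^ j)" for j
    using prod_t_shift[of t j] by (simp add: field_simps)
  moreover have "v_num t n = (\<Prod>j<n. (1 - t ^ Suc j) / (1 - t))"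
    unfolding v_num_def by (rule prod.reindex_bij_witness[where i = Suc and j = "\<lambda>i. i - 1"]) auto
  ultimately have "(\<Prod>j<n. \<Prod>i<j. t ^ i - t * t ^ j) = v_num t n * vandermonde n (\<lambda>i. t ^ i)"
    by (simp only: vandermonde_def prod.distrib)
  moreover have "(\<Prod>i<n. (t ^ i) ^ lam i) = t ^ (\<Sum>i<n. i * lam i)"
    by (simp add: power_sum power_mult)
  ultimately have "hl_num t n lam (\<lambda>i. t ^ i)
      = t ^ (\<Sum>i<n. i * lam i) * v_num t n * vandermonde n (\<lambda>i. t ^ i)"
    by (simp add: hl_num_principal hl_summand_def)
  with meval_hall_littlewood[of "\<lambda>i. t ^ i" t n lam]
  have "meval (\<lambda>i. t ^ i) (hall_littlewood t n lam) * vandermonde n (\<lambda>i. t ^ i)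
      = t ^ (\<Sum>i<n. i * lam i) * v_num t n / v_part t n lam * vandermonde n (\<lambda>i. t ^ i)"
    by simp
  with V show ?thesis
    by (metis mult_right_cancel)
qed

section \<open>Staircases and multiplicities\<close>

lemma parts_of_append:
  "parts_of (ys @ xs) i = (if i < length ys then ys ! i else parts_of xs (i - length ys))"
  by (auto simp: parts_of_def nth_append)

lemma stair_list_Suc: "k > 0 \<Longrightarrow> stair_list w s (Suc k) = replicate s (w * k) @ stair_list w s k"
  by (simp add: stair_list_def)

lemma stair_list_1: "stair_list w s (Suc 0) = []"
  by (simp add: stair_list_def)

lemma length_stair_list: "length (stair_list w s (Suc k)) = s * k"
  by (induction k) (simp_all add: stair_list_Suc stair_list_1)

lemma set_stair_list: "set (stair_list w s (Suc k)) \<subseteq> (\<lambda>j. w * j) ` {1..k}"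
  by (induction k) (auto simp: stair_list_Suc stair_list_1 atLeastAtMostSuc_conv)

lemma sum_list_stair_list: "2 * sum_list (stair_list w s (Suc k)) = w * s * (k * Suc k)"
  by (induction k) (simp_all add: stair_list_Suc stair_list_1 sum_list_replicate algebra_simps)

lemma plength_parts_of:
  assumes "0 \<notin> set xs"
  shows "plength (parts_of xs) = length xs"
proof -
  have "{i. parts_of xs i \<noteq> 0} = {..<length xs}"
    using assms by (auto simp: parts_of_def in_set_conv_nth split: if_splits)
  then show ?thesis by (simp add: plength_def)
qed

lemma card_parts_of_nonzero:
  assumes "j \<noteq> 0" "length xs \<le> n"
  shows "card {i. i < n \<and> parts_of xs i = j} = count_list xs j"
proof -
  have "{i. i < n \<and> parts_of xs i = j} = {i. i < length xs \<and> xs ! i = j}"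
    using assms by (auto simp: parts_of_def split: if_splits)
  also have "card \<dots> = count_list xs j"
    by (simp add: count_list_eq_length_filter length_filter_conv_card eq_commute)
  finally show ?thesis .
qed

lemma card_parts_of_zero:
  assumes "0 \<notin> set xs" "length xs \<le> n"
  shows "card {i. i < n \<and> parts_of xs i = 0} = n - length xs"
proof -
  have zero_iff: "parts_of xs i = 0 \<longleftrightarrow> length xs \<le> i" for i
  proof (cases "i < length xs")
    case True
    then have "xs ! i \<noteq> 0" using assms(1) nth_mem by metis
    with True show ?thesis by (simp add: parts_of_def)
  qed (simp add: parts_of_def)
  have "{i. i < n \<and> parts_of xs i = 0} = {length xs..<n}"
    by (simp add: zero_iff set_eq_iff conj_commute)
  then show ?thesis by simp
qed

lemma v_num_0: "v_num t 0 = 1"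
  by (simp add: v_num_def)

text \<open>
  The product in \<open>v_part\<close> runs over the values attained among the first \<open>n\<close> parts, and
  $0$ is one of them only if \<open>n\<close> exceeds the length. Since $v_0 = 1$, it makes no difference to
  always include $0$, which avoids a case distinction.
\<close>

lemma v_part_parts_of:
  assumes "0 \<notin> set xs" "length xs \<le> n"
  shows "v_part t n (parts_of xs) = v_num t (n - length xs) * (\<Prod>j\<in>set xs. v_num t (count_list xs j))"
proof -
  let ?c = "\<lambda>j. card {i. i < n \<and> parts_of xs i = j}"
  have "v_part t n (parts_of xs) = (\<Prod>j\<in>insert 0 (set xs). v_num t (?c j))"
    unfolding v_part_def
  proof (rule prod.mono_neutral_left)
    show "parts_of xs ` {..<n} \<subseteq> insert 0 (set xs)"
      by (auto simp: parts_of_def)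
    show "\<forall>j\<in>insert 0 (set xs) - parts_of xs ` {..<n}. v_num t (?c j) = 1"
    proof
      fix j assume "j \<in> insert 0 (set xs) - parts_of xs ` {..<n}"
      then have "{i. i < n \<and> parts_of xs i = j} = {}" by auto
      then show "v_num t (?c j) = 1" by (simp only: card.empty v_num_0)
    qed
  qed simp
  also have "\<dots> = v_num t (n - length xs) * (\<Prod>j\<in>set xs. v_num t (?c j))"
    using assms by (simp add: card_parts_of_zero)
  also have "(\<Prod>j\<in>set xs. v_num t (?c j)) = (\<Prod>j\<in>set xs. v_num t (count_list xs j))"
    using assms by (intro prod.cong refl arg_cong[of _ _ "v_num t"] card_parts_of_nonzero) metis+
  finally show ?thesis .
qed

text \<open>
  The \<open>g\<close> new parts take \<open>g\<close> zeros away and leave all other multiplicities alone.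
\<close>

lemma v_part_replicate_append:
  assumes "0 \<notin> set xs" "a \<noteq> 0" "a \<notin> set xs" "g + length xs \<le> n"
  shows "v_part t n (parts_of (replicate g a @ xs)) * v_num t (n - length xs)
       = v_num t g * v_num t (n - length xs - g) * v_part t n (parts_of xs)"
proof (cases "g = 0")
  case False
  have "(\<Prod>j\<in>set (replicate g a @ xs). v_num t (count_list (replicate g a @ xs) j))
      = v_num t g * (\<Prod>j\<in>set xs. v_num t (count_list xs j))"
  proof -
    have "count_list (replicate g a) j = (if j = a then g else 0)" for j
      by (induction g) auto
    moreover have "set (replicate g a @ xs) = insert a (set xs)"
      using False by simp
    moreover have "count_list xs a = 0" using assms by (simp add: count_list_0_iff)
    ultimately show ?thesis
      using assms by (auto intro!: prod.cong)
  qed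
  moreover have "v_part t n (parts_of (replicate g a @ xs)) = v_num t (n - length (replicate g a @ xs)) *
      (\<Prod>j\<in>set (replicate g a @ xs). v_num t (count_list (replicate g a @ xs) j))"
    using assms by (intro v_part_parts_of) auto
  moreover have "n - length (replicate g a @ xs) = n - length xs - g" by simp
  ultimately show ?thesis
    using assms by (simp add: v_part_parts_of)
qed (simp add: v_num_0)

lemma sum_parts_of: "length xs \<le> m \<Longrightarrow> (\<Sum>i<m. parts_of xs i) = sum_list xs"
proof -
  assume "length xs \<le> m"
  then have "(\<Sum>i<m. parts_of xs i) = (\<Sum>i<length xs. parts_of xs i)"
    by (intro sum.mono_neutral_right) (auto simp: parts_of_def)
  then show ?thesis by (simp add: parts_of_def sum_list_sum_nth atLeast0LessThan)
qed

text \<open>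
  The old parts move \<open>g\<close> places to the right, so each of them contributes \<open>g\<close> times its
  size to the increase.
\<close>

lemma weighted_sum_replicate_append:
  assumes "g + length xs \<le> n"
  shows "(\<Sum>i<n. i * parts_of (replicate g a @ xs) i)
       = a * (\<Sum>i<g. i) + g * sum_list xs + (\<Sum>i<n. i * parts_of xs i)"
proof -
  obtain m where m: "n = g + m" "length xs \<le> m"
    using assms by (metis le_add1 le_Suc_ex add_le_cancel_left le_trans)
  let ?p = "parts_of (replicate g a @ xs)"
  have "(\<Sum>i<n. i * ?p i) = (\<Sum>i<g. i * ?p i) + (\<Sum>i<m. (g + i) * ?p (g + i))"
    unfolding m(1) by (induction m) auto
  also have "(\<Sum>i<g. i * ?p i) = a * (\<Sum>i<g. i)"
    by (simp add: parts_of_append sum_distrib_left mult.commute)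
  also have "(\<Sum>i<m. (g + i) * ?p (g + i)) = g * (\<Sum>i<m. parts_of xs i) + (\<Sum>i<m. i * parts_of xs i)"
    by (simp add: parts_of_append add_mult_distrib sum.distrib sum_distrib_left)
  also have "(\<Sum>i<m. i * parts_of xs i) = (\<Sum>i<n. i * parts_of xs i)"
    using m by (intro sum.mono_neutral_left) (auto simp: parts_of_def)
  finally show ?thesis using m by (simp add: sum_parts_of)
qed

section \<open>The quotient of specializations\<close>

text \<open>
  Exactly what is needed for the points $t^i$ to be distinct and for all denominators to be nonzero.
\<close>

locale not_root_of_unity =
  fixes t :: "'a::field"
  assumes nonzero: "t \<noteq> 0" and power_neq_1: "i > 0 \<Longrightarrow> t ^ i \<noteq> 1"
begin

lemma v_num_nz: "v_num t m \<noteq> 0"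
  using power_neq_1[of 1] power_neq_1 by (simp add: v_num_def)

lemma v_part_nz: "v_part t n lam \<noteq> 0"
  by (simp add: v_part_def v_num_nz)

lemma qpoch_conv_v_num: "qpoch t t m = (1 - t) ^ m * v_num t m"
proof -
  have "v_num t m = (\<Prod>i<m. (1 - t ^ Suc i) / (1 - t))"
    unfolding v_num_def by (rule prod.reindex_bij_witness[where i = Suc and j = "\<lambda>i. i - 1"]) auto
  then show ?thesis
    using power_neq_1[of 1] by (simp add: qpoch_def prod_dividef)
qed

lemma qpoch_nz: "qpoch t t m \<noteq> 0"
  using power_neq_1[of 1] by (simp add: qpoch_conv_v_num v_num_nz)

lemma gaussian_conv_v_num:
  "b \<le> a \<Longrightarrow> gaussian t a b = v_num t a / (v_num t b * v_num t (a - b))"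
  using power_neq_1[of 1] by (simp add: gaussian_def qpoch_conv_v_num field_simps flip: power_add)

lemma specialization_ratio:
  assumes "0 \<notin> set xs" "a \<noteq> 0" "a \<notin> set xs" "g + length xs \<le> n"
  shows "meval (\<lambda>i. t ^ i) (hall_littlewood t n (parts_of (replicate g a @ xs)))
         / meval (\<lambda>i. t ^ i) (hall_littlewood t n (parts_of xs))
       = t ^ (a * (\<Sum>i<g. i) + g * sum_list xs) * gaussian t (n - length xs) g"
proof -
  note P = principal_specialization[OF nonzero power_neq_1]
  let ?v = "v_part t n (parts_of xs)" and ?v' = "v_part t n (parts_of (replicate g a @ xs))"
  have v: "?v' = v_num t g * v_num t (n - length xs - g) * ?v / v_num t (n - length xs)"
    using v_part_replicate_append[OF assms, of t] by (simp add: field_simps v_num_nz)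
  show ?thesis
    using assms(4)
    by (simp add: P weighted_sum_replicate_append v gaussian_conv_v_num power_add
        v_num_nz v_part_nz nonzero)
qed

section \<open>Gaussian polynomials count partitions in a box\<close>

lemma qpoch_Suc: "qpoch t t (Suc m) = qpoch t t m * (1 - t ^ Suc m)"
  by (simp add: qpoch_def)

lemma gaussian_pascal:
  "gaussian t (Suc m + Suc g) (Suc g) = gaussian t (Suc m + g) g + t ^ Suc g * gaussian t (m + Suc g) (Suc g)"
proof -
  define q where "q = qpoch t t (m + Suc g)"
  have q': "qpoch t t (Suc m + g) = q" "qpoch t t (Suc m + Suc g) = q * (1 - t ^ Suc (m + Suc g))"
    unfolding q_def by (simp_all only: qpoch_Suc add_Suc add_Suc_right)
  have nz: "1 - t ^ Suc i \<noteq> 0" for i using power_neq_1[of "Suc i"] by simp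
  define A where "A = t ^ Suc m"
  define B where "B = t ^ Suc g"
  have AB: "t ^ Suc (m + Suc g) = A * B" by (simp add: A_def B_def power_add)
  have cd: "1 - A \<noteq> 0" "1 - B \<noteq> 0" using nz by (simp_all only: A_def B_def not_False_eq_True)
  have "q * (1 - A * B) / (y * (1 - B) * (x * (1 - A)))
      = q / (y * (x * (1 - A))) + B * (q / (y * (1 - B) * x))"
    if "x \<noteq> 0" "y \<noteq> 0" for x y
  proof -
    have "q * (1 - (1 - c) * (1 - d)) / (y * d * (x * c)) = q / (y * (x * c)) + (1 - d) * (q / (y * d * x))"
      if "c \<noteq> 0" "d \<noteq> 0" for c d
      using that \<open>x \<noteq> 0\<close> \<open>y \<noteq> 0\<close> by (simp add: field_simps)
    from this[OF cd] show ?thesis by simp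
  qed
  from this[OF qpoch_nz[of m] qpoch_nz[of g]] show ?thesis
    unfolding gaussian_def q' add_diff_cancel_right' qpoch_Suc[of m] qpoch_Suc[of g] q_def[symmetric]
      AB A_def[symmetric] B_def[symmetric] .
qed

end

definition box :: "nat \<Rightarrow> nat \<Rightarrow> (nat \<Rightarrow> nat) set" where
  "box m g = {\<nu>. is_partition \<nu> \<and> contained \<nu> (rect m g)}"

lemma support_subset_lessThan:
  fixes \<nu> :: "nat \<Rightarrow> nat"
  assumes "\<forall>i\<ge>g. \<nu> i = 0"
  shows "{i. \<nu> i \<noteq> 0} \<subseteq> {..<g}"
proof
  fix i assume "i \<in> {i. \<nu> i \<noteq> 0}"
  then show "i \<in> {..<g}" using assms by (cases "i < g") simp_all
qed

lemma box_iff: "\<nu> \<in> box m g \<longleftrightarrow> antimono \<nu> \<and> (\<forall>i. \<nu> i \<le> m) \<and> (\<forall>i\<ge>g. \<nu> i = 0)"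
proof -
  have "finite {i. \<nu> i \<noteq> 0}" if "\<forall>i\<ge>g. \<nu> i = 0"
    using support_subset_lessThan[OF that] finite_subset by blast
  moreover have "contained \<nu> (rect m g) \<longleftrightarrow> (\<forall>i. \<nu> i \<le> m) \<and> (\<forall>i\<ge>g. \<nu> i = 0)"
  proof -
    have "\<nu> i \<le> rect m g i \<longleftrightarrow> \<nu> i \<le> m \<and> (g \<le> i \<longrightarrow> \<nu> i = 0)" for i
      by (auto simp: rect_def parts_of_def)
    then show ?thesis by (auto simp: contained_def)
  qed
  ultimately show ?thesis by (auto simp: box_def is_partition_def)
qed

lemma psize_box:
  assumes "\<nu> \<in> box m g"
  shows "psize \<nu> = (\<Sum>i<g. \<nu> i)"
proof -
  have "{i. \<nu> i \<noteq> 0} \<subseteq> {..<g}"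
    using assms by (intro support_subset_lessThan) (simp add: box_iff)
  then show ?thesis
    unfolding psize_def by (intro sum.mono_neutral_left) auto
qed

lemma box_trivial:
  assumes "m = 0 \<or> g = 0"
  shows "box m g = {\<lambda>_. 0}"
proof (intro equalityI subsetI)
  fix \<nu> assume "\<nu> \<in> box m g"
  with assms have "\<nu> i = 0" for i by (auto simp: box_iff)
  then show "\<nu> \<in> {\<lambda>_. 0}" by (simp add: fun_eq_iff)
next
  fix \<nu> assume "\<nu> \<in> {\<lambda>_ :: nat. 0 :: nat}"
  then show "\<nu> \<in> box m g" by (simp add: box_iff antimono_def)
qed

lemma finite_box: "finite (box m g)"
proof (rule finite_subset)
  show "box m g \<subseteq> {f. \<forall>i. (i \<in> {..<g} \<longrightarrow> f i \<in> {..m}) \<and> (i \<notin> {..<g} \<longrightarrow> f i = 0)}"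
    by (auto simp: box_iff)
qed (intro finite_set_of_finite_funs, auto)

definition add_column :: "nat \<Rightarrow> (nat \<Rightarrow> nat) \<Rightarrow> nat \<Rightarrow> nat" where
  "add_column g \<nu> i = (if i < g then Suc (\<nu> i) else 0)"

text \<open>
  Partitions in the larger box have either fewer than $g + 1$ parts or exactly $g + 1$. In the
  second case the first column of the diagram is full, and removing it leaves a partition in a
  box that is one unit narrower.
\<close>

lemma box_split: "box (Suc m) (Suc g) = box (Suc m) g \<union> add_column (Suc g) ` box m (Suc g)"
proof (intro equalityI subsetI)
  fix \<nu> assume \<nu>: "\<nu> \<in> box (Suc m) (Suc g)"
  show "\<nu> \<in> box (Suc m) g \<union> add_column (Suc g) ` box m (Suc g)"
  proof (cases "\<nu> g = 0")
    case True
    then have "\<nu> \<in> box (Suc m) g"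
      using \<nu> unfolding box_iff by (metis le_SucE le_eq_less_or_eq not_less_eq_eq Suc_leI)
    then show ?thesis by blast
  next
    case False
    have pos: "\<nu> i > 0" if "i \<le> g" for i
      using \<nu> False that unfolding box_iff antimono_def by (metis gr_zeroI le_zero_eq)
    have "antimono (\<lambda>i. \<nu> i - 1)"
      using \<nu> by (simp add: box_iff antimono_def diff_le_mono)
    then have "(\<lambda>i. \<nu> i - 1) \<in> box m (Suc g)"
      using \<nu> by (simp add: box_iff le_diff_conv)
    moreover have "\<nu> = add_column (Suc g) (\<lambda>i. \<nu> i - 1)"
      using \<nu> pos by (auto simp: fun_eq_iff add_column_def box_iff less_Suc_eq_le)
    ultimately show ?thesis by blast
  qed
next
  fix \<nu> assume "\<nu> \<in> box (Suc m) g \<union> add_column (Suc g) ` box m (Suc g)"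
  then show "\<nu> \<in> box (Suc m) (Suc g)"
    unfolding Un_iff image_iff box_iff Bex_def
    by (auto simp: add_column_def antimono_def)
qed

lemma box_split_disjoint: "box (Suc m) g \<inter> add_column (Suc g) ` box m (Suc g) = {}"
proof -
  have "add_column (Suc g) \<nu> \<notin> box (Suc m) g" for \<nu>
    unfolding box_iff by (auto simp: add_column_def intro!: exI[of _ g])
  then show ?thesis by blast
qed

lemma add_column_inj: "inj_on (add_column g) (box m g)"
proof (rule inj_onI, rule ext)
  fix \<nu> \<nu>' i assume \<nu>: "\<nu> \<in> box m g" "\<nu>' \<in> box m g" and "add_column g \<nu> = add_column g \<nu>'"
  then have "add_column g \<nu> i = add_column g \<nu>' i" by simp
  with \<nu> show "\<nu> i = \<nu>' i"
    by (cases "i < g") (auto simp: add_column_def box_iff)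
qed

lemma psize_add_column:
  assumes "\<nu> \<in> box m g"
  shows "psize (add_column g \<nu>) = g + psize \<nu>"
proof -
  have "psize (add_column g \<nu>) = (\<Sum>i<g. add_column g \<nu> i)"
    unfolding psize_def by (intro sum.mono_neutral_left) (auto simp: add_column_def split: if_splits)
  also have "\<dots> = g + (\<Sum>i<g. \<nu> i)"
    by (simp add: add_column_def sum_Suc)
  finally show ?thesis using assms by (simp add: psize_box)
qed

lemma (in not_root_of_unity) sum_box: "(\<Sum>\<nu>\<in>box m g. t ^ psize \<nu>) = gaussian t (m + g) g"
proof (induction "m + g" arbitrary: m g)
  case 0
  then show ?case by (simp add: box_trivial psize_def gaussian_def qpoch_def)
next
  case (Suc n)
  show ?case
  proof (cases "m = 0 \<or> g = 0")
    case True
    then show ?thesis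
      by (subst box_trivial) (use qpoch_nz in \<open>auto simp: psize_def gaussian_def qpoch_def\<close>)
  next
    case False
    then obtain m' g' where mg: "m = Suc m'" "g = Suc g'" by (metis not0_implies_Suc)
    have "(\<Sum>\<nu>\<in>box m g. t ^ psize \<nu>)
        = (\<Sum>\<nu>\<in>box m g'. t ^ psize \<nu>) + (\<Sum>\<nu>\<in>add_column g ` box m' g. t ^ psize \<nu>)"
      unfolding mg box_split
      by (intro sum.union_disjoint finite_imageI finite_box box_split_disjoint)
    also have "(\<Sum>\<nu>\<in>add_column g ` box m' g. t ^ psize \<nu>)
        = (\<Sum>\<nu>\<in>box m' g. t ^ g * t ^ psize \<nu>)"
      by (subst sum.reindex[OF add_column_inj]) (simp add: psize_add_column power_add cong: sum.cong)
    also have "\<dots> = t ^ g * (\<Sum>\<nu>\<in>box m' g. t ^ psize \<nu>)"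
      by (simp only: sum_distrib_left)
    also have "(\<Sum>\<nu>\<in>box m g'. t ^ psize \<nu>) = gaussian t (m + g') g'"
      using Suc by (intro Suc.hyps) (simp add: mg)
    also have "(\<Sum>\<nu>\<in>box m' g. t ^ psize \<nu>) = gaussian t (m' + g) g"
      using Suc by (intro Suc.hyps) (simp add: mg)
    finally show ?thesis
      unfolding mg gaussian_pascal .
  qed
qed

section \<open>Generalized staircases\<close>

lemma not_root_of_unity_tvar: "not_root_of_unity tvar"
proof
  show "tvar \<noteq> 0" by (simp add: tvar_def Zero_fract_def eq_fract)
next
  fix i :: nat assume "i > 0"
  have "tvar ^ i = Fract ([:0, 1:] ^ i) 1"
    unfolding tvar_def by (simp only: ring_morphism.power[OF ring_morphism_Fract])
  moreover have "([:0, 1:] :: rat poly) ^ i \<noteq> 1"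
  proof
    assume "([:0, 1:] :: rat poly) ^ i = 1"
    then have "degree (([:0, 1:] :: rat poly) ^ i) = 0" by simp
    then show False using \<open>i > 0\<close> by (simp add: degree_power_eq)
  qed
  ultimately show "tvar ^ i \<noteq> 1" by (simp add: One_fract_def eq_fract)
qed

theorem theorem7p1:
  fixes k w s n g :: nat
  assumes "k > 0" and "w > 0" and "s > 0" and "n > 0"
    and "g \<le> s"
    and "n \<ge> plength (stair_mid w s k g)"
  shows "HL_spec n (stair_mid w s k g) / HL_spec n (stair w s k)
           = tvar ^ ((w * k * g * (g - 1)) div 2 + (w * g * s * k * (k - 1)) div 2)
             * gaussian tvar (n - s * (k - 1)) g
         \<and> tvar powi (- int ((w * k * g * (g - 1)) div 2) - int ((w * g * s * k * (k - 1)) div 2))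
           * (HL_spec n (stair_mid w s k g) / HL_spec n (stair w s k))
           = (\<Sum>\<nu> | is_partition \<nu> \<and> contained \<nu> (rect (n - s * (k - 1) - g) g).
                tvar ^ psize \<nu>)"
proof -
  interpret not_root_of_unity tvar by (rule not_root_of_unity_tvar)
  let ?xs = "stair_list w s k"
  let ?a = "(w * k * g * (g - 1)) div 2" and ?b = "(w * g * s * k * (k - 1)) div 2"
  obtain k' where k: "k = Suc k'" using assms(1) by (cases k) auto
  have sub: "set ?xs \<subseteq> (\<lambda>j. w * j) ` {1..k'}" using set_stair_list k by simp
  have notin: "0 \<notin> set ?xs" "w * k \<notin> set ?xs" "w * k \<noteq> 0"
    using sub assms(1,2) k by (fastforce simp del: mult_Suc_right)+
  have len: "length ?xs = s * (k - 1)" by (simp add: k length_stair_list)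
  have "plength (stair_mid w s k g) = g + length ?xs"
    unfolding stair_mid_def using notin by (subst plength_parts_of) auto
  with assms(6) have n: "g + length ?xs \<le> n" by simp
  have "2 * (\<Sum>i<g. i) = g * (g - 1)"
  proof (induction g)
    case (Suc g)
    then show ?case by (cases g) (simp_all add: algebra_simps)
  qed simp
  then have "2 * (w * k * (\<Sum>i<g. i)) = w * k * g * (g - 1)"
    by (metis mult.assoc mult.left_commute)
  then have a: "w * k * (\<Sum>i<g. i) = ?a" by linarith
  have "2 * (g * sum_list ?xs) = w * g * s * k * (k - 1)"
    using sum_list_stair_list[of w s k'] by (simp add: k algebra_simps)
  then have b: "g * sum_list ?xs = ?b" by linarith
  have ratio: "HL_spec n (stair_mid w s k g) / HL_spec n (stair w s k)
     = tvar ^ (?a + ?b) * gaussian tvar (n - s * (k - 1)) g"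
    unfolding HL_spec_def stair_mid_def stair_def a[symmetric] b[symmetric] len[symmetric]
    by (rule specialization_ratio) (use notin n in auto)
  have "tvar powi (- int ?a - int ?b) * tvar ^ (?a + ?b) = 1"
  proof -
    have "- int ?a - int ?b = - int (?a + ?b)" by simp
    then show ?thesis by (simp only: power_int_minus power_int_of_nat) (simp add: nonzero)
  qed
  moreover have "gaussian tvar (n - s * (k - 1)) g
     = (\<Sum>\<nu>\<in>box (n - s * (k - 1) - g) g. tvar ^ psize \<nu>)"
    using n by (simp add: sum_box len)
  ultimately show ?thesis
    unfolding ratio box_def by (simp add: mult.assoc[symmetric])
qed

end
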